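(* Let $t_0 \in \mathbb{R}$ and let $f: \mathbb{R} \rightarrow \mathbb{R}$ be of the form $f(t) = (g \circ \varphi)(t)$ for $t \in \mathbb{R}$, where $\varphi: \mathbb{R} \to \mathbb{R}^m$ is differentiable at $t_0$ and $g: \mathbb{R}^m \to \mathbb{R}$ is directed subdifferentiable and locally Lipschitz at $\varphi(t_0)$. Then $f: \mathbb{R} \rightarrow \mathbb{R}$ is directed subdifferentiable at $t_0$ with $$\overrightarrow{\partial} f(t_0) = \overrightarrow{[-g'(\varphi(t_0); -\varphi'(t_0)),\ g'(\varphi(t_0); \varphi'(t_0))]}.$$
   Context: Notation. $\mathcal{S}_{n-1}$ is the Euclidean unit sphere in $\mathbb{R}^n$ (so $\mathcal{S}_0=\{-1,1\}$). The (Dini) directional derivative of $f:\mathbb{R}^n\to\mathbb{R}$ at $x$ in direction $l$ is $f'(x;l)=\lim_{t\downarrow 0}\frac{f(x+tl)-f(x)}{t}$. For $n\ge 2$ and $l\in\mathcal{S}_{n-1}$, $\Pi_{n-1,l}:\mathbb{R}^n\to\mathbb{R}^{n-1}$ is a fixed linear map that maps the orthogonal complement of $l$ isometrically onto $\mathbb{R}^{n-1}$ and maps $l$ to $0$; its transpose $\Pi_{n-1,l}^\top:\mathbb{R}^{n-1}\to\mathbb{R}^n$ maps $\mathbb{R}^{n-1}$ onto the orthogonal complement of $l$ and inverts the restriction of $\Pi_{n-1,l}$ to that complement. Directed subdifferentiable functions. A function $f:\mathbb{R}\to\mathbb{R}$ is $M$-directed subdifferentiable at $x\in\mathbb{R}$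 if $f'(x;1)$ and $f'(x;-1)$ exist and $\max\{|f'(x;-1)|,|f'(x;1)|\}\le M$. A function $f:\mathbb{R}^n\to\mathbb{R}$, $n\ge2$, is $M$-directed subdifferentiable at $x\in\mathbb{R}^n$ if $f'(x;l)$ exists for every $l$, is continuous as a function of $l$, satisfies $\max_{l\in\mathcal{S}_{n-1}}|f'(x;l)|\le M$, and for every $l\in\mathcal{S}_{n-1}$ the function $f_l:\mathbb{R}^{n-1}\to\mathbb{R}$, $f_l(\cdot)=f'(x;l+\Pi_{n-1,l}^\top(\cdot))$, is $M$-directed subdifferentiable at $0_{n-1}$. $f$ is directed subdifferentiable at $x$ if it is $M$-directed subdifferentiable at $x$ for some $M\ge 0$. A directed interval $\overrightarrow{[a,b]}$, with $a,b\in\mathbb{R}$ arbitrary (not necessarily $a\le b$), is the ordered pair $(-a,b)$, indexed by the directions $(-1,1)$. For $f:\mathbb{R}\to\mathbb{R}$ directed subdifferentiable at $t_0$, the directed subdifferential is the directed interval $\overrightarrow{\partial} f(t_0)=\overrightarrow{[-f'(t_0;-1),f'(t_0;1)]}$, i.e. the pair $(f'(t_0;-1),f'(t_0;1))$. "Locally Lipschitz at a point" means Lipschitz continuous on a neighbourhood of that point. *)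

theory Defs
  imports "HOL-Analysis.Analysis"
begin

text \<open>
  The definition of directed subdifferentiability recurses on the dimension, so \<open>\<real>\<^sup>n\<close> is the
  carrier of the library topology \<^term>\<open>Euclidean_space n\<close>: the sequences \<^typ>\<open>nat \<Rightarrow> real\<close> that
  vanish from index \<open>n\<close> on. A function on \<open>\<real>\<^sup>n\<close> is a total function on sequences of which only
  the values on that carrier are used. The unit sphere of \<open>\<real>\<^sup>n\<close> is the carrier of
  \<^term>\<open>nsphere (n - 1)\<close>.
\<close>

abbreviation Rn :: "nat \<Rightarrow> (nat \<Rightarrow> real) set"
  where "Rn n \<equiv> topspace (Euclidean_space n)"

definition Rn_inner :: "nat \<Rightarrow> (nat \<Rightarrow> real) \<Rightarrow> (nat \<Rightarrow> real) \<Rightarrow> real"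
  where "Rn_inner n x y = (\<Sum>i<n. x i * y i)"

definition Rn_dist :: "nat \<Rightarrow> (nat \<Rightarrow> real) \<Rightarrow> (nat \<Rightarrow> real) \<Rightarrow> real"
  where "Rn_dist n x y = L2_set (\<lambda>i. x i - y i) {..<n}"

text \<open>Application of an \<open>r \<times> c\<close> matrix; entries outside this range are irrelevant.\<close>

definition mat_app ::
    "nat \<Rightarrow> nat \<Rightarrow> (nat \<Rightarrow> nat \<Rightarrow> real) \<Rightarrow> (nat \<Rightarrow> real) \<Rightarrow> (nat \<Rightarrow> real)"
  where "mat_app r c A x = (\<lambda>i. if i < r then \<Sum>j<c. A i j * x j else 0)"

text \<open>
  \<open>P k l\<close> is the \<open>k \<times> (k + 1)\<close> matrix of the map written \<open>\<Pi>\<close> with indices \<open>k\<close> and \<open>l\<close>, where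
  \<open>k = n - 1 \<ge> 1\<close> and \<open>l\<close> is a unit vector of \<open>\<real>\<^sup>n\<close>. The maps are otherwise arbitrary but fixed,
  so the family \<open>P\<close> is a parameter of everything that depends on it.
\<close>

definition projection_family :: "(nat \<Rightarrow> (nat \<Rightarrow> real) \<Rightarrow> nat \<Rightarrow> nat \<Rightarrow> real) \<Rightarrow> bool"
  where "projection_family P \<longleftrightarrow>
    (\<forall>k\<ge>1. \<forall>l \<in> topspace (nsphere k).
       let A = mat_app k (Suc k) (P k l);
           l_perp = {x \<in> Rn (Suc k). Rn_inner (Suc k) l x = 0}
       in A l = (\<lambda>i. 0) \<and>
          A ` l_perp = Rn k \<and>
          (\<forall>x\<in>l_perp. \<forall>y\<in>l_perp. Rn_dist k (A x) (A y) = Rn_dist (Suc k) x y))"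

definition projection_transpose ::
    "(nat \<Rightarrow> (nat \<Rightarrow> real) \<Rightarrow> nat \<Rightarrow> nat \<Rightarrow> real) \<Rightarrow> nat \<Rightarrow> (nat \<Rightarrow> real) \<Rightarrow>
     (nat \<Rightarrow> real) \<Rightarrow> (nat \<Rightarrow> real)"
  where "projection_transpose P k l = mat_app (Suc k) k (\<lambda>i j. P k l j i)"

text \<open>
  The Dini directional derivative, on the real line and on \<open>\<real>\<^sup>n\<close>. The functions written with
  \<^const>\<open>Lim\<close> are meaningful only where the derivative exists.
\<close>

definition has_dir_deriv :: "(real \<Rightarrow> real) \<Rightarrow> real \<Rightarrow> real \<Rightarrow> real \<Rightarrow> bool"
  where "has_dir_deriv f x l d \<longleftrightarrow> ((\<lambda>t. (f (x + t * l) - f x) / t) \<longlongrightarrow> d) (at_right 0)"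

definition dir_deriv :: "(real \<Rightarrow> real) \<Rightarrow> real \<Rightarrow> real \<Rightarrow> real"
  where "dir_deriv f x l = Lim (at_right 0) (\<lambda>t. (f (x + t * l) - f x) / t)"

definition has_dir_deriv_vec ::
    "((nat \<Rightarrow> real) \<Rightarrow> real) \<Rightarrow> (nat \<Rightarrow> real) \<Rightarrow> (nat \<Rightarrow> real) \<Rightarrow> real \<Rightarrow> bool"
  where "has_dir_deriv_vec f x l d \<longleftrightarrow>
    ((\<lambda>t. (f (\<lambda>i. x i + t * l i) - f x) / t) \<longlongrightarrow> d) (at_right 0)"

definition dir_deriv_vec ::
    "((nat \<Rightarrow> real) \<Rightarrow> real) \<Rightarrow> (nat \<Rightarrow> real) \<Rightarrow> (nat \<Rightarrow> real) \<Rightarrow> real"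
  where "dir_deriv_vec f x l = Lim (at_right 0) (\<lambda>t. (f (\<lambda>i. x i + t * l i) - f x) / t)"

definition M_directed_subdiff_real :: "real \<Rightarrow> (real \<Rightarrow> real) \<Rightarrow> real \<Rightarrow> bool"
  where "M_directed_subdiff_real M f x \<longleftrightarrow>
    (\<exists>d. has_dir_deriv f x 1 d) \<and> (\<exists>d. has_dir_deriv f x (-1) d) \<and>
    max \<bar>dir_deriv f x (-1)\<bar> \<bar>dir_deriv f x 1\<bar> \<le> M"

definition directed_subdiff_real :: "(real \<Rightarrow> real) \<Rightarrow> real \<Rightarrow> bool"
  where "directed_subdiff_real f x \<longleftrightarrow> (\<exists>M\<ge>0. M_directed_subdiff_real M f x)"

definition vec1 :: "real \<Rightarrow> (nat \<Rightarrow> real)"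
  where "vec1 s = (\<lambda>i. if i = 0 then s else 0)"

text \<open>
  The third argument is the dimension. Dimension 1 is the real-line notion under the identification
  \<^const>\<open>vec1\<close> of \<open>\<real>\<close> with its one-dimensional copy; dimension 0 is excluded.
\<close>

fun M_directed_subdiff ::
    "(nat \<Rightarrow> (nat \<Rightarrow> real) \<Rightarrow> nat \<Rightarrow> nat \<Rightarrow> real) \<Rightarrow> real \<Rightarrow> nat \<Rightarrow>
     ((nat \<Rightarrow> real) \<Rightarrow> real) \<Rightarrow> (nat \<Rightarrow> real) \<Rightarrow> bool"
  where
    "M_directed_subdiff P M 0 f x \<longleftrightarrow> False"
  | "M_directed_subdiff P M (Suc 0) f x \<longleftrightarrow> M_directed_subdiff_real M (\<lambda>s. f (vec1 s)) (x 0)"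
  | "M_directed_subdiff P M (Suc (Suc k)) f x \<longleftrightarrow>
       (\<forall>l \<in> Rn (Suc (Suc k)). \<exists>d. has_dir_deriv_vec f x l d) \<and>
       continuous_map (Euclidean_space (Suc (Suc k))) euclideanreal (dir_deriv_vec f x) \<and>
       (\<forall>l \<in> topspace (nsphere (Suc k)). \<bar>dir_deriv_vec f x l\<bar> \<le> M) \<and>
       (\<forall>l \<in> topspace (nsphere (Suc k)).
          M_directed_subdiff P M (Suc k)
            (\<lambda>y. dir_deriv_vec f x (\<lambda>i. l i + projection_transpose P (Suc k) l y i)) (\<lambda>i. 0))"

definition directed_subdiff ::
    "(nat \<Rightarrow> (nat \<Rightarrow> real) \<Rightarrow> nat \<Rightarrow> nat \<Rightarrow> real) \<Rightarrow> nat \<Rightarrow>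
     ((nat \<Rightarrow> real) \<Rightarrow> real) \<Rightarrow> (nat \<Rightarrow> real) \<Rightarrow> bool"
  where "directed_subdiff P n f x \<longleftrightarrow> (\<exists>M\<ge>0. M_directed_subdiff P M n f x)"

text \<open>The components are those in the directions \<open>-1\<close> and \<open>1\<close>; \<open>a \<le> b\<close> is not required.\<close>

definition directed_interval :: "real \<Rightarrow> real \<Rightarrow> real \<times> real"
  where "directed_interval a b = (- a, b)"

definition directed_subdifferential :: "(real \<Rightarrow> real) \<Rightarrow> real \<Rightarrow> real \<times> real"
  where "directed_subdifferential f t = directed_interval (- dir_deriv f t (-1)) (dir_deriv f t 1)"

definition has_curve_derivative ::
    "nat \<Rightarrow> (real \<Rightarrow> nat \<Rightarrow> real) \<Rightarrow> (nat \<Rightarrow> real) \<Rightarrow> real \<Rightarrow> bool"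
  where "has_curve_derivative n \<phi> v t \<longleftrightarrow>
    limitin (Euclidean_space n) (\<lambda>h i. (\<phi> (t + h) i - \<phi> t i) / h) v (at 0)"

definition locally_Lipschitz_at ::
    "nat \<Rightarrow> ((nat \<Rightarrow> real) \<Rightarrow> real) \<Rightarrow> (nat \<Rightarrow> real) \<Rightarrow> bool"
  where "locally_Lipschitz_at n f x \<longleftrightarrow>
    (\<exists>U L. openin (Euclidean_space n) U \<and> x \<in> U \<and> 0 \<le> L \<and>
       (\<forall>y\<in>U. \<forall>z\<in>U. \<bar>f y - f z\<bar> \<le> L * Rn_dist n y z))"

end

(* The Lipschitz bound makes the difference quotient of g along the curve asymptotic to the one
   along its tangent ray. The latter converges because directed subdifferentiability provides
   derivatives in all directions, by positive homogeneity in dimension 1. *)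
theory Submission
  imports Defs
begin

text \<open>\<open>Euclidean_space n\<close> carries the subspace topology of a product of real
  lines, so convergence in it reduces to real limits, one for each coordinate.\<close>

lemma limitin_Euclidean_space_iff:
  "limitin (Euclidean_space n) c x F \<longleftrightarrow>
     x \<in> Rn n \<and> (\<forall>\<^sub>F t in F. c t \<in> Rn n) \<and> (\<forall>i. ((\<lambda>t. c t i) \<longlongrightarrow> x i) F)"
  unfolding Euclidean_space_def limitin_subtopology limitin_componentwise
  by (auto simp: eventually_conj_iff elim: eventually_mono)

lemma Rn_line:
  assumes "x \<in> Rn n" "v \<in> Rn n"
  shows "(\<lambda>i. x i + t * v i) \<in> Rn n"
  using assms by (simp add: topspace_Euclidean_space)

lemma vec1_component_zero:
  assumes "x \<in> Rn 1"
  shows "vec1 (x 0) = x"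
  using assms by (auto simp: topspace_Euclidean_space vec1_def fun_eq_iff)

lemma dir_deriv_eqI: "has_dir_deriv f x l d \<Longrightarrow> dir_deriv f x l = d"
  unfolding has_dir_deriv_def dir_deriv_def by (intro tendsto_Lim) simp_all

lemma dir_deriv_vec_eqI: "has_dir_deriv_vec f x l d \<Longrightarrow> dir_deriv_vec f x l = d"
  unfolding has_dir_deriv_vec_def dir_deriv_vec_def by (intro tendsto_Lim) simp_all

text \<open>On the line the bound comes for free: the larger of the two absolute values serves as
  \<open>M\<close>.\<close>

lemma directed_subdiff_realI:
  assumes "has_dir_deriv f x 1 d" and "has_dir_deriv f x (-1) e"
  shows "directed_subdiff_real f x"
proof -
  have "M_directed_subdiff_real (max \<bar>e\<bar> \<bar>d\<bar>) f x"
    using assms dir_deriv_eqI[OF assms(1)] dir_deriv_eqI[OF assms(2)]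
    unfolding M_directed_subdiff_real_def by blast
  moreover have "0 \<le> max \<bar>e\<bar> \<bar>d\<bar>"
    by simp
  ultimately show ?thesis
    unfolding directed_subdiff_real_def by blast
qed

text \<open>For c > 0 the substitution t -> t * c preserves the limit from the right; for c = 0 the
  difference quotient vanishes identically.\<close>

lemma has_dir_deriv_scale:
  assumes "has_dir_deriv f x l d" and "0 \<le> c"
  shows "has_dir_deriv f x (c * l) (c * d)"
proof (cases "c = 0")
  case False
  with assms(2) have c: "0 < c" by simp
  have "filterlim (\<lambda>t. t * c) (at_right 0) (at_right 0)"
    using c by (auto simp: filterlim_at eventually_at_filter intro!: tendsto_eq_intros)
  from filterlim_compose[OF assms(1)[unfolded has_dir_deriv_def] this]
  have "((\<lambda>t. c * ((f (x + t * c * l) - f x) / (t * c))) \<longlongrightarrow> c * d) (at_right 0)"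
    by (intro tendsto_mult_left)
  then show ?thesis
    using c by (simp add: has_dir_deriv_def mult.assoc)
qed (simp add: has_dir_deriv_def)

text \<open>From dimension 2 on, the definition itself asks for derivatives in all directions, not
  only unit ones. Dimension 1 supplies just the directions 1 and -1, and the others follow by
  scaling.\<close>

lemma directed_subdiff_has_dir_deriv_vec:
  assumes "directed_subdiff P n f x" and x: "x \<in> Rn n" and l: "l \<in> Rn n"
  obtains d where "has_dir_deriv_vec f x l d"
proof -
  obtain M where M: "M_directed_subdiff P M n f x"
    using assms(1) by (auto simp: directed_subdiff_def)
  consider "n = 0" | "n = 1" | "n = Suc (Suc (n - 2))"
    by linarith
  then have "\<exists>d. has_dir_deriv_vec f x l d"
  proof cases
    case 1
    then show ?thesis
      using M by simp
  next
    case 2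
    let ?h = "\<lambda>s. f (vec1 s)"
    obtain d e where d: "has_dir_deriv ?h (x 0) 1 d" and e: "has_dir_deriv ?h (x 0) (-1) e"
      using M 2 by (auto simp: M_directed_subdiff_real_def)
    have "\<exists>d. has_dir_deriv ?h (x 0) (l 0) d"
      \<comment> \<open>The sign of \<open>l 0\<close> decides which unit direction is scaled:
        \<open>l 0\<close> is \<open>l 0\<close> times 1 and also \<open>- l 0\<close> times -1, and
        the factor must be nonnegative.\<close>
      using has_dir_deriv_scale[OF d, of "l 0"] has_dir_deriv_scale[OF e, of "- l 0"]
      by (cases "0 \<le> l 0") auto
    moreover have "vec1 (x 0 + t * l 0) = (\<lambda>i. x i + t * l i)" for t
      using vec1_component_zero[of "\<lambda>i. x i + t * l i"] Rn_line[OF x l] 2 by simp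
    ultimately show ?thesis
      using vec1_component_zero[of x] x 2 by (simp add: has_dir_deriv_def has_dir_deriv_vec_def)
  next
    case 3
    then have "\<forall>l \<in> Rn n. \<exists>d. has_dir_deriv_vec f x l d"
      using M M_directed_subdiff.simps(3)[of P M "n - 2" f x] by metis
    with l show ?thesis by blast
  qed
  then show ?thesis using that by blast
qed

text \<open>A one-sided derivative at 0 forces \<open>c t\<close> to tend to \<open>x\<close> from
  the right, since \<open>c t\<close> equals \<open>x\<close> plus \<open>t\<close> times the
  difference quotient for t > 0. The value of \<open>c\<close> at 0 does not enter.\<close>

lemma eventually_curve_in_open:
  assumes "openin (Euclidean_space n) U" "x \<in> U"
    and "\<And>t. c t \<in> Rn n"
    and deriv: "\<And>i. ((\<lambda>t. (c t i - x i) / t) \<longlongrightarrow> v i) (at_right 0)"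
  shows "\<forall>\<^sub>F t in at_right (0::real). c t \<in> U"
proof -
  have "((\<lambda>t. c t i) \<longlongrightarrow> x i) (at_right 0)" for i
  proof -
    have "((\<lambda>t. x i + t * ((c t i - x i) / t)) \<longlongrightarrow> x i + 0 * v i) (at_right 0)"
      by (intro tendsto_intros deriv)
    moreover have "\<forall>\<^sub>F t in at_right 0. x i + t * ((c t i - x i) / t) = c t i"
      by (simp add: eventually_at_filter)
    ultimately show ?thesis
      using Lim_transform_eventually by fastforce
  qed
  moreover have "x \<in> Rn n"
    using assms(1,2) openin_subset by blast
  ultimately have "limitin (Euclidean_space n) c x (at_right 0)"
    using assms(3) by (simp add: limitin_Euclidean_space_iff)
  with assms(1,2) show ?thesis
    by (simp add: limitin_def)
qed

text \<open>The curve and the ray \<open>x + t * v\<close> differ by o(t), so by the Lipschitz bound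
  the values of \<open>g\<close> on them do too.\<close>

lemma has_dir_deriv_vec_along_curve:
  assumes lip: "locally_Lipschitz_at n g x"
    and dd: "has_dir_deriv_vec g x v d"
    and x: "x \<in> Rn n" and v: "v \<in> Rn n"
    and c: "\<And>t. c t \<in> Rn n"
    and deriv: "\<And>i. ((\<lambda>t. (c t i - x i) / t) \<longlongrightarrow> v i) (at_right 0)"
  shows "((\<lambda>t. (g (c t) - g x) / t) \<longlongrightarrow> d) (at_right (0::real))"
proof -
  obtain U L where U: "openin (Euclidean_space n) U" "x \<in> U" and L: "0 \<le> L"
    and le: "\<And>y z. y \<in> U \<Longrightarrow> z \<in> U \<Longrightarrow> \<bar>g y - g z\<bar> \<le> L * Rn_dist n y z"
    using lip unfolding locally_Lipschitz_at_def by blast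
  let ?line = "\<lambda>t i. x i + t * v i"
  \<comment> \<open>The Lipschitz estimate holds only inside \<open>U\<close>, so the ray must be
    there for small \<open>t\<close> as well; it is itself a curve with derivative
    \<open>v\<close>.\<close>
  have "((\<lambda>t. (?line t i - x i) / t) \<longlongrightarrow> v i) (at_right 0)" for i
    by (rule Lim_transform_eventually[OF tendsto_const]) (simp add: eventually_at_filter)
  then have ev_line: "\<forall>\<^sub>F t in at_right 0. ?line t \<in> U"
    by (rule eventually_curve_in_open[OF U Rn_line[OF x v]])
  have ev_c: "\<forall>\<^sub>F t in at_right 0. c t \<in> U"
    using eventually_curve_in_open[OF U c deriv] .
  have "((\<lambda>t. L * (\<Sum>i<n. \<bar>(c t i - x i) / t - v i\<bar>)) \<longlongrightarrow> L * (\<Sum>i<n. \<bar>v i - v i\<bar>))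
      (at_right 0)"
    by (intro tendsto_intros deriv)
  then have lim0: "((\<lambda>t. L * (\<Sum>i<n. \<bar>(c t i - x i) / t - v i\<bar>)) \<longlongrightarrow> 0) (at_right 0)"
    by simp
  have "\<forall>\<^sub>F t in at_right 0.
      norm ((g (c t) - g (?line t)) / t) \<le> L * (\<Sum>i<n. \<bar>(c t i - x i) / t - v i\<bar>)"
    using ev_c ev_line eventually_at_right_less[of 0]
  proof eventually_elim
    case (elim t)
    have "\<bar>g (c t) - g (?line t)\<bar> \<le> L * Rn_dist n (c t) (?line t)"
      using le elim by blast
    \<comment> \<open>Passing from the Euclidean norm to the sum of absolute values lets the
      coordinatewise limits in \<open>deriv\<close> suffice.\<close>
    also have "\<dots> \<le> L * (\<Sum>i<n. \<bar>c t i - ?line t i\<bar>)"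
      unfolding Rn_dist_def by (intro mult_left_mono L2_set_le_sum_abs L)
    finally have "\<bar>g (c t) - g (?line t)\<bar> / t \<le> L * (\<Sum>i<n. \<bar>c t i - ?line t i\<bar>) / t"
      using elim by (simp add: divide_right_mono)
    also have "\<dots> = L * (\<Sum>i<n. \<bar>c t i - ?line t i\<bar> / t)"
      by (simp flip: sum_divide_distrib)
    also have "(\<Sum>i<n. \<bar>c t i - ?line t i\<bar> / t) = (\<Sum>i<n. \<bar>(c t i - x i) / t - v i\<bar>)"
    proof (rule sum.cong[OF refl])
      fix i
      have "(c t i - x i) / t - v i = (c t i - ?line t i) / t"
        using elim by (simp add: field_simps)
      then show "\<bar>c t i - ?line t i\<bar> / t = \<bar>(c t i - x i) / t - v i\<bar>"
        using elim by simp
    qed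
    finally show ?case
      using elim by simp
  qed
  from Lim_null_comparison[OF this lim0]
  have "((\<lambda>t. (g (c t) - g (?line t)) / t + (g (?line t) - g x) / t) \<longlongrightarrow> 0 + d) (at_right 0)"
    using dd unfolding has_dir_deriv_vec_def by (intro tendsto_add)
  then show ?thesis
    by (simp add: diff_divide_distrib)
qed

text \<open>The substitution h -> h * s sends a right neighbourhood of 0 into a punctured one, on
  either side according to the sign of \<open>s\<close>. The two-sided derivative thus serves
  forward and backward directions alike.\<close>

lemma has_curve_derivative_ray:
  assumes "has_curve_derivative n \<phi> v t" and "s \<noteq> 0"
  shows "((\<lambda>h. (\<phi> (t + h * s) i - \<phi> t i) / h) \<longlongrightarrow> s * v i) (at_right 0)"
proof -
  have "((\<lambda>h. (\<phi> (t + h) i - \<phi> t i) / h) \<longlongrightarrow> v i) (at 0)"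
    using assms(1) by (simp add: has_curve_derivative_def limitin_Euclidean_space_iff)
  moreover have "filterlim (\<lambda>h. h * s) (at 0) (at_right 0)"
    using assms(2) by (auto simp: filterlim_at eventually_at_filter intro!: tendsto_eq_intros)
  ultimately have "((\<lambda>h. s * ((\<phi> (t + h * s) i - \<phi> t i) / (h * s))) \<longlongrightarrow> s * v i) (at_right 0)"
    by (intro tendsto_mult_left) (rule filterlim_compose)
  then show ?thesis
    using assms(2) by simp
qed

theorem proposition4p3:
  fixes P :: "nat \<Rightarrow> (nat \<Rightarrow> real) \<Rightarrow> nat \<Rightarrow> nat \<Rightarrow> real"
    and m :: nat
    and t0 :: real
    and f :: "real \<Rightarrow> real"
    and g :: "(nat \<Rightarrow> real) \<Rightarrow> real"
    and \<phi> :: "real \<Rightarrow> nat \<Rightarrow> real"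
    and \<phi>' :: "nat \<Rightarrow> real"
  assumes "projection_family P"
    and "m \<ge> 1"
    and "\<And>t. \<phi> t \<in> Rn m"
    and "\<And>t. f t = g (\<phi> t)"
    and "has_curve_derivative m \<phi> \<phi>' t0"
    and "directed_subdiff P m g (\<phi> t0)"
    and "locally_Lipschitz_at m g (\<phi> t0)"
  shows "directed_subdiff_real f t0 \<and>
    directed_subdifferential f t0 =
      directed_interval (- dir_deriv_vec g (\<phi> t0) (\<lambda>i. - \<phi>' i)) (dir_deriv_vec g (\<phi> t0) \<phi>')"
proof -
  have \<phi>': "\<phi>' \<in> Rn m"
    using assms(5) unfolding has_curve_derivative_def by (rule limitin_topspace)
  have ray: "has_dir_deriv f t0 s (dir_deriv_vec g (\<phi> t0) (\<lambda>i. s * \<phi>' i))" if "s \<noteq> 0" for s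
  proof -
    have l: "(\<lambda>i. s * \<phi>' i) \<in> Rn m"
      using \<phi>' by (simp add: topspace_Euclidean_space)
    \<comment> \<open>\<open>dir_deriv_vec\<close> is a \<open>Lim\<close>, so it can be identified
      with the limit along the curve only once the derivative of \<open>g\<close> is known to
      exist.\<close>
    obtain d where d: "has_dir_deriv_vec g (\<phi> t0) (\<lambda>i. s * \<phi>' i) d"
      using directed_subdiff_has_dir_deriv_vec[OF assms(6) assms(3) l] .
    then have "((\<lambda>t. (g (\<phi> (t0 + t * s)) - g (\<phi> t0)) / t) \<longlongrightarrow> d) (at_right 0)"
      by (rule has_dir_deriv_vec_along_curve[OF assms(7) _ assms(3) l assms(3)
            has_curve_derivative_ray[OF assms(5) that]])
    then show ?thesis
      using dir_deriv_vec_eqI[OF d] assms(4) by (simp add: has_dir_deriv_def)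
  qed
  show ?thesis
    \<comment> \<open>The values s = 1 and s = -1 give the two components of the directed interval,
      with directions \<open>\<phi>'\<close> and its negative.\<close>
    using ray[of 1] ray[of "-1"]
    by (auto simp: directed_subdifferential_def dir_deriv_eqI intro: directed_subdiff_realI)
qed

end
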